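(* Let $0<\alpha\leq1$. For every $f\in\mathcal{G}(\alpha)$ one has $$|S'_f(0)|\leq \alpha^2+2\alpha.$$ This bound is sharp, i.e., for each such $\alpha$ there is a function $f\in\mathcal{G}(\alpha)$ for which equality holds.
   Context: Let $\mathbb{D}=\{z\in\mathbb{C}:|z|<1\}$, and let $\mathcal{A}$ be the family of functions $f$ analytic in $\mathbb{D}$ with $f(0)=0$ and $f'(0)=1$. For $0<\alpha\leq1$, $\mathcal{G}(\alpha)$ is the class of $f\in\mathcal{A}$ with $f'(z)\neq0$ in $\mathbb{D}$ (so that the following expression is defined) and $$\operatorname{Re}\left[1+\frac{zf''(z)}{f'(z)}\right]<1+\frac12\alpha\quad\text{for all } z\in\mathbb{D}.$$ For a locally univalent function $f$ in $\mathbb{D}$, the Schwarzian derivative is $$S_f(z)=\left(\frac{f''(z)}{f'(z)}\right)'-\frac12\left(\frac{f''(z)}{f'(z)}\right)^2,$$ and $S'_f(0)$ denotes the value at $0$ of the derivative of the function $S_f$. *)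

theory Defs
  imports "HOL-Complex_Analysis.Complex_Analysis"
begin

abbreviation unit_disc :: "complex set" where
  "unit_disc \<equiv> ball 0 1"

(* Functions are total on the complex numbers; values outside the open disc are irrelevant,
   since only values and derivatives at points of the (open) disc are ever used. *)
definition class_A :: "(complex \<Rightarrow> complex) set" where
  "class_A = {f. f analytic_on unit_disc \<and> f 0 = 0 \<and> deriv f 0 = 1}"

definition class_G :: "real \<Rightarrow> (complex \<Rightarrow> complex) set" where
  "class_G \<alpha> = {f \<in> class_A.
     (\<forall>z\<in>unit_disc. deriv f z \<noteq> 0) \<and>
     (\<forall>z\<in>unit_disc. Re (1 + z * deriv (deriv f) z / deriv f z) < 1 + (1/2) * \<alpha>)}"

definition schwarzian :: "(complex \<Rightarrow> complex) \<Rightarrow> complex \<Rightarrow> complex" where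
  "schwarzian f z =
     deriv (\<lambda>w. deriv (deriv f) w / deriv f w) z
       - (1/2) * (deriv (deriv f) z / deriv f z)\<^sup>2"

end

(* Write T = f''/f'. For f in G(alpha) the function p(z) = 1 - (2/alpha) z T(z) has positive real
   part and p(0) = 1, so Caratheodory's bound |p_n| <= 2 on its Taylor coefficients gives
   |T^(n)(0)| <= n! alpha. Since S_f'(0) = T''(0) - T(0) T'(0), the bound 2 alpha + alpha^2 follows.
   Equality holds when p(z) = (1 + z)/(1 - z), that is, f'(z) = (1 - z)^alpha. *)
theory Submission
  imports Defs
begin

section \<open>Caratheodory's coefficient bound for functions with non-negative real part\<close>

text \<open>On the circle of radius \<open>r < 1\<close>, the mean of \<open>Re f\<close> against a
  suitable non-negative trigonometric weight equals \<open>2 * Re (f 0) - norm a * r ^ n\<close>,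
  where \<open>a\<close> is the \<open>n\<close>-th Taylor coefficient. This is therefore
  non-negative, and \<open>r\<close> tends to 1.\<close>

lemma Caratheodory_coeff_bound:
  fixes f :: "complex \<Rightarrow> complex"
  assumes holf: "f holomorphic_on ball 0 1"
    and pos: "\<And>z. z \<in> ball 0 1 \<Longrightarrow> 0 \<le> Re (f z)"
    and n: "0 < n"
  shows "norm ((deriv ^^ n) f 0 / fact n) \<le> 2 * Re (f 0)"
proof -
  define a where "a = (deriv ^^ n) f 0 / fact n"
  have bound: "norm a * r ^ n \<le> 2 * Re (f 0)" if r: "0 < r" "r < 1" for r :: real
  proof -
    obtain c where c: "norm c = 1" "c * a = - of_real (norm a)"
    proof (cases "a = 0")
      case True then show ?thesis using that[of 1] by simp
    next
      case False
      have "(- cnj a / of_real (norm a)) * a = - of_real (norm a)"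
        using False complex_norm_square[of a] by (simp add: field_simps power2_eq_square)
      then show ?thesis using that[of "- cnj a / of_real (norm a)"] False
        by (simp add: norm_divide)
    qed
    have sub: "cball 0 r \<subseteq> ball (0::complex) 1" using r by auto
    have holc: "f holomorphic_on cball 0 r" using holf sub holomorphic_on_subset by blast
    have contf: "continuous_on (cball 0 r) f" by (rule holomorphic_on_imp_continuous_on[OF holc])
    have holb: "f holomorphic_on ball 0 r" using holc holomorphic_on_subset ball_subset_cball by blast
    let ?g = "circlepath 0 r"
    have A: "((\<lambda>u. f u / (u - 0)) has_contour_integral (2 * of_real pi * \<i> * f 0)) ?g"
      by (rule Cauchy_integral_circlepath_simple[OF holc]) (use r in auto)
    have B: "((\<lambda>u. f u / (u - 0) ^ Suc n) has_contour_integral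
        ((2 * pi * \<i>) / fact n * (deriv ^^ n) f 0)) ?g"
      by (rule Cauchy_has_contour_integral_higher_derivative_circlepath[OF contf holb]) (use r in auto)
    \<comment> \<open>With respect to \<open>du / u\<close>, the integrals \<open>A\<close>,
      \<open>B\<close>, \<open>C\<close> test \<open>f\<close> against 1, \<open>u ^ -n\<close> and
      \<open>u ^ n\<close>. The last one vanishes by Cauchy's theorem, as \<open>0 < n\<close> makes
      its integrand holomorphic.\<close>
    have C: "((\<lambda>u. f u * u ^ (n - 1)) has_contour_integral 0) ?g"
      by (rule Cauchy_theorem_convex_simple[where S="ball 0 1"])
         (use r in \<open>auto intro!: holomorphic_intros holf simp: path_image_circlepath\<close>)
    text \<open>On the circle \<open>u = r e\<close> this is \<open>f u / u\<close> times the real weight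
      \<open>2 + 2 Re (c / e ^ n) \<ge> 0\<close>; the rotation \<open>c\<close> makes the \<open>n\<close>-th coefficient count negatively.\<close>
    let ?h = "\<lambda>u. 2 * (f u / (u - 0)) + c * of_real (r ^ n) * (f u / (u - 0) ^ Suc n)
                + cnj c / of_real (r ^ n) * (f u * u ^ (n - 1))"
    have "(?h has_contour_integral
        (2 * (2 * of_real pi * \<i> * f 0) + c * of_real (r ^ n) * ((2 * pi * \<i>) / fact n * (deriv ^^ n) f 0)
          + cnj c / of_real (r ^ n) * 0)) ?g"
      by (intro has_contour_integral_add has_contour_integral_lmul A B C)
    also have "2 * (2 * of_real pi * \<i> * f 0) + c * of_real (r ^ n) * ((2 * pi * \<i>) / fact n * (deriv ^^ n) f 0)
          + cnj c / of_real (r ^ n) * 0 = (2 * of_real pi * \<i>) * (2 * f 0 + of_real (r ^ n) * (c * a))"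
      by (simp add: a_def algebra_simps)
    finally have "((\<lambda>t. ?h (?g t) * vector_derivative ?g (at t within {0..1})) has_integral
        (2 * of_real pi * \<i>) * (2 * f 0 + of_real (r ^ n) * (c * a))) {0..1}"
      unfolding has_contour_integral_def .
    \<comment> \<open>Since \<open>du / (2 pi i u) = dt\<close>, dividing by \<open>2 pi i\<close>
      gives a mean over the circle, whose real part can be compared with 0 pointwise.\<close>
    then have "((\<lambda>t. Re (1 / (2 * of_real pi * \<i>) * (?h (?g t) * vector_derivative ?g (at t within {0..1})))) has_integral
        Re (1 / (2 * of_real pi * \<i>) * ((2 * of_real pi * \<i>) * (2 * f 0 + of_real (r ^ n) * (c * a))))) {0..1}"
      by (intro has_integral_Re has_integral_mult_right)
    moreover have "0 \<le> Re (1 / (2 * of_real pi * \<i>) * (?h (?g t) * vector_derivative ?g (at t within {0..1})))"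
      if t: "t \<in> {0..1}" for t
    proof -
      define e where "e = exp (2 * of_real pi * \<i> * of_real t)"
      have e: "norm e = 1" by (simp add: e_def norm_exp_eq_Re)
      then have e0: "e \<noteq> 0" by auto
      \<comment> \<open>Conjugation is inversion on the unit circle, so the terms with
        \<open>c / e ^ n\<close> and \<open>cnj c * e ^ n\<close> are conjugate and their sum is
        real.\<close>
      have ce: "cnj e = 1 / e"
        using e complex_norm_square[of e] e0 by (simp add: field_simps)
      have u: "?g t = of_real r * e" by (simp add: circlepath e_def)
      have vd: "vector_derivative ?g (at t within {0..1}) = 2 * of_real pi * \<i> * (of_real r * e)"
        using t by (simp add: vector_derivative_circlepath01 e_def)
      obtain m where m: "n = Suc m" using n by (cases n) auto
      define w where "w = c / e ^ n"
      have cw: "cnj w = cnj c * e ^ n" by (simp add: w_def ce power_divide)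
      have "1 / (2 * of_real pi * \<i>) * (?h (?g t) * vector_derivative ?g (at t within {0..1}))
          = f (of_real r * e) * (2 + w + cnj w)"
        unfolding u vd cw unfolding w_def using r e0
        by (simp add: m field_simps power_mult_distrib)
      also have "2 + w + cnj w = of_real (2 + 2 * Re w)"
        by (simp add: complex_add_cnj add.assoc)
      finally have eq: "Re (1 / (2 * of_real pi * \<i>) * (?h (?g t) * vector_derivative ?g (at t within {0..1})))
          = Re (f (of_real r * e)) * (2 + 2 * Re w)"
        by (simp del: of_real_add of_real_mult)
      have "norm w = 1" by (simp add: w_def norm_divide norm_power e c)
      then have "2 + 2 * Re w \<ge> 0" using abs_Re_le_cmod[of w] by linarith
      moreover have "0 \<le> Re (f (of_real r * e))"
        using r e by (intro pos) (simp add: norm_mult)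
      ultimately show ?thesis unfolding eq by simp
    qed
    ultimately have "0 \<le> Re (1 / (2 * of_real pi * \<i>) * ((2 * of_real pi * \<i>) * (2 * f 0 + of_real (r ^ n) * (c * a))))"
      by (rule has_integral_nonneg)
    also have "\<dots> = Re (2 * f 0 + of_real (r ^ n) * (c * a))" by simp
    also have "\<dots> = 2 * Re (f 0) - norm a * r ^ n" unfolding c(2) by (simp add: mult.commute)
    finally show ?thesis by simp
  qed
  \<comment> \<open>Nothing is assumed about \<open>f\<close> on the unit circle itself, so the
    radius 1 is reached only as a limit.\<close>
  have "((\<lambda>r. norm a * r ^ n) \<longlongrightarrow> norm a * 1 ^ n) (at_left (1::real))"
    by (intro tendsto_intros)
  moreover have "eventually (\<lambda>r. norm a * r ^ n \<le> 2 * Re (f 0)) (at_left 1)"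
    using eventually_at_left_real[of 0 1] by (auto elim!: eventually_mono intro: bound)
  ultimately have "norm a * 1 ^ n \<le> 2 * Re (f 0)"
    by (intro tendsto_upperbound) auto
  then show ?thesis by (simp add: a_def)
qed

section \<open>The derivative of the Schwarzian in terms of \<open>f''/f'\<close>\<close>

text \<open>Differentiate \<open>g' - g^2 / 2\<close>. As \<open>deriv\<close> is local, agreement
  of \<open>f''/f'\<close> with \<open>g\<close> on an open set suffices; this allows
  \<open>g\<close> to be a closed form valid only in the disc.\<close>

lemma deriv_schwarzian:
  assumes "open S" "z \<in> S" and holg: "g holomorphic_on S"
    and eq: "\<And>w. w \<in> S \<Longrightarrow> deriv (deriv f) w / deriv f w = g w"
  shows "deriv (schwarzian f) z = deriv (deriv g) z - g z * deriv g z"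
proof -
  have ev: "schwarzian f w = deriv g w - (1/2) * (g w)\<^sup>2" if "w \<in> S" for w
  proof -
    have "deriv (\<lambda>w. deriv (deriv f) w / deriv f w) w = deriv g w"
      using assms(1) that eq by (intro deriv_cong_ev eventually_nhds_in_open[THEN eventually_mono]) auto
    then show ?thesis using eq[OF that] by (simp add: schwarzian_def)
  qed
  have "deriv (schwarzian f) z = deriv (\<lambda>w. deriv g w - (1/2) * (g w)\<^sup>2) z"
    using assms(1,2) ev by (intro deriv_cong_ev eventually_nhds_in_open[of S, THEN eventually_mono]) auto
  also have "\<dots> = deriv (deriv g) z - g z * deriv g z"
  proof (rule DERIV_imp_deriv)
    have "(g has_field_derivative deriv g z) (at z)"
      using holomorphic_derivI[OF holg assms(1,2)] .
    moreover have "(deriv g has_field_derivative deriv (deriv g) z) (at z)"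
      using holomorphic_derivI[OF holomorphic_deriv[OF holg assms(1)] assms(1,2)] .
    ultimately show "((\<lambda>w. deriv g w - (1/2) * (g w)\<^sup>2) has_field_derivative
        deriv (deriv g) z - g z * deriv g z) (at z)"
      by (auto intro!: derivative_eq_intros)
  qed
  finally show ?thesis .
qed

section \<open>Coefficient bounds for \<open>f''/f'\<close> in the class G(\<alpha>)\<close>

text \<open>In the Leibniz sum only \<open>i = 1\<close> survives, because every other derivative of
  the identity vanishes at 0.\<close>

lemma higher_deriv_ident_mult_at_0:
  assumes "g holomorphic_on S" "open S" "0 \<in> S"
  shows "(deriv ^^ Suc n) (\<lambda>z. z * g z) 0 = of_nat (Suc n) * (deriv ^^ n) g 0"
proof -
  have "(deriv ^^ Suc n) (\<lambda>z. z * g z) 0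
      = (\<Sum>i = 0..Suc n. of_nat (Suc n choose i) * (deriv ^^ i) (\<lambda>z. z) 0 * (deriv ^^ (Suc n - i)) g 0)"
    using assms by (intro higher_deriv_mult[where S=S]) (auto intro: holomorphic_intros)
  also have "\<dots> = (\<Sum>i \<in> {1}. of_nat (Suc n choose i) * (deriv ^^ i) (\<lambda>z. z) 0 * (deriv ^^ (Suc n - i)) g 0)"
    by (rule sum.mono_neutral_right) (auto simp: higher_deriv_id)
  finally show ?thesis by (simp add: higher_deriv_id del: funpow.simps)
qed

text \<open>The factor \<open>z\<close> in \<open>p\<close> shifts indices: the coefficient of
  \<open>p\<close> of order \<open>n + 1\<close> is \<open>- 2 / \<alpha>\<close> times the
  \<open>n\<close>-th coefficient of \<open>?T\<close>. Caratheodory's bound, which needs positive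
  order, thus covers every \<open>n\<close>, including 0.\<close>

lemma class_G_pre_schwarzian_coeff_bound:
  assumes \<alpha>: "0 < \<alpha>" and f: "f \<in> class_G \<alpha>"
  shows "(\<lambda>z. deriv (deriv f) z / deriv f z) holomorphic_on ball 0 1" (is "?T holomorphic_on _")
    and "norm ((deriv ^^ n) (\<lambda>z. deriv (deriv f) z / deriv f z) 0) \<le> fact n * \<alpha>"
proof -
  have holf: "f holomorphic_on ball 0 1"
    using f by (simp add: class_G_def class_A_def analytic_on_open)
  have "\<forall>z\<in>ball 0 1. deriv f z \<noteq> 0"
    using f unfolding class_G_def by blast
  then show holT: "?T holomorphic_on ball 0 1"
    by (intro holomorphic_on_divide holomorphic_deriv holf open_ball) auto
  define p where "p = (\<lambda>z. 1 - of_real (2 / \<alpha>) * (z * ?T z))"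
  have holp: "p holomorphic_on ball 0 1"
    unfolding p_def by (intro holomorphic_intros holT)
  have Re_p: "0 \<le> Re (p z)" if "z \<in> ball 0 1" for z
  proof -
    have Re_aux: "Re (1 - of_real a * w) = 1 - a * Re w" for a w by simp
    have "Re (1 + z * deriv (deriv f) z / deriv f z) < 1 + (1/2) * \<alpha>"
      using f that unfolding class_G_def by blast
    then have "Re (z * ?T z) < \<alpha> / 2" by simp
    then have "2 / \<alpha> * Re (z * ?T z) \<le> 2 / \<alpha> * (\<alpha> / 2)"
      using \<alpha> by (intro mult_left_mono) auto
    then have "2 / \<alpha> * Re (z * ?T z) \<le> 1" using \<alpha> by simp
    moreover have "Re (p z) = 1 - 2 / \<alpha> * Re (z * ?T z)"
      using Re_aux[of "2 / \<alpha>" "z * ?T z"] unfolding p_def .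
    ultimately show ?thesis by simp
  qed
  have holzT: "(\<lambda>z. z * ?T z) holomorphic_on ball 0 1"
    by (intro holomorphic_intros holT)
  have "(deriv ^^ Suc n) p 0 = - (of_real (2 / \<alpha>) * (deriv ^^ Suc n) (\<lambda>z. z * ?T z) 0)"
  proof -
    have "(deriv ^^ Suc n) p 0 = (deriv ^^ Suc n) (\<lambda>z. 1) 0
        - (deriv ^^ Suc n) (\<lambda>z. of_real (2 / \<alpha>) * (z * ?T z)) 0"
      unfolding p_def
      by (rule higher_deriv_diff[OF holomorphic_on_const holomorphic_on_mult[OF holomorphic_on_const holzT]]) auto
    also have "(deriv ^^ Suc n) (\<lambda>z. of_real (2 / \<alpha>) * (z * ?T z)) 0
        = of_real (2 / \<alpha>) * (deriv ^^ Suc n) (\<lambda>z. z * ?T z) 0"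
      by (rule higher_deriv_cmult[OF holzT]) auto
    finally show ?thesis by (simp add: higher_deriv_const del: funpow.simps)
  qed
  also have "(deriv ^^ Suc n) (\<lambda>z. z * ?T z) 0 = of_nat (Suc n) * (deriv ^^ n) ?T 0"
    by (rule higher_deriv_ident_mult_at_0[OF holT]) auto
  finally have dp: "(deriv ^^ Suc n) p 0 / fact (Suc n) = - (of_real (2 / \<alpha>) * (deriv ^^ n) ?T 0 / fact n)"
    by (simp add: field_simps del: funpow.simps of_nat_Suc)
  have "norm ((deriv ^^ Suc n) p 0 / fact (Suc n)) \<le> 2 * Re (p 0)"
    by (rule Caratheodory_coeff_bound[OF holp Re_p]) auto
  then have "2 / \<alpha> * norm ((deriv ^^ n) ?T 0) / fact n \<le> 2"
    unfolding dp using \<alpha> by (simp add: norm_mult norm_divide p_def)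
  then show "norm ((deriv ^^ n) ?T 0) \<le> fact n * \<alpha>"
    using \<alpha> by (simp add: field_simps)
qed

lemma class_G_deriv_schwarzian_bound:
  assumes \<alpha>: "0 < \<alpha>" and f: "f \<in> class_G \<alpha>"
  shows "norm (deriv (schwarzian f) 0) \<le> \<alpha>\<^sup>2 + 2 * \<alpha>"
proof -
  define T where "T = (\<lambda>z. deriv (deriv f) z / deriv f z)"
  note coeff = class_G_pre_schwarzian_coeff_bound[OF \<alpha> f, folded T_def]
  have "norm (deriv (schwarzian f) 0) = norm (deriv (deriv T) 0 - T 0 * deriv T 0)"
    by (subst deriv_schwarzian[OF _ _ coeff(1)]) (auto simp: T_def)
  also have "\<dots> \<le> norm (deriv (deriv T) 0) + norm (T 0) * norm (deriv T 0)"
    using norm_triangle_ineq4 by (metis norm_mult)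
  \<comment> \<open>The orders 0, 1, 2 are used; the summand \<open>2 * \<alpha>\<close> comes from
    \<open>fact 2\<close>.\<close>
  also have "\<dots> \<le> 2 * \<alpha> + \<alpha> * \<alpha>"
    using coeff(2)[of 0] coeff(2)[of 1] coeff(2)[of 2] \<alpha>
    by (intro add_mono mult_mono) (auto simp: numeral_2_eq_2)
  finally show ?thesis by (simp add: power2_eq_square)
qed

section \<open>Sharpness: the extremal function\<close>

text \<open>The primitive of \<open>(1 - z) powr \<alpha>\<close> that vanishes at 0.\<close>

definition G_extremal :: "real \<Rightarrow> complex \<Rightarrow> complex" where
  "G_extremal \<alpha> z = (1 - (1 - z) powr (of_real \<alpha> + 1)) / (of_real \<alpha> + 1)"

text \<open>Keeps \<open>1 - z\<close> away from 0 and from the branch cut of \<open>powr\<close>,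
  so the principal branch is holomorphic throughout the disc.\<close>

lemma Re_one_minus_pos:
  assumes "z \<in> ball (0::complex) 1"
  shows "0 < Re (1 - z)"
  using assms abs_Re_le_cmod[of z] by simp

lemma one_minus_not_nonpos_Reals:
  assumes "z \<in> ball (0::complex) 1"
  shows "1 - z \<notin> \<real>\<^sub>\<le>\<^sub>0"
  using Re_one_minus_pos[OF assms] by (auto simp: complex_nonpos_Reals_iff)

lemma G_extremal_has_field_derivative:
  assumes "0 < \<alpha>" "z \<in> ball 0 1"
  shows "(G_extremal \<alpha> has_field_derivative (1 - z) powr of_real \<alpha>) (at z)"
proof -
  have "complex_of_real \<alpha> + 1 \<noteq> 0"
    using assms(1) by (simp add: complex_eq_iff)
  moreover have "((\<lambda>z. (1 - z) powr (of_real \<alpha> + 1)) has_field_derivative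
      - (of_real \<alpha> + 1) * (1 - z) powr of_real \<alpha>) (at z)"
    using one_minus_not_nonpos_Reals[OF assms(2)] by (auto intro!: derivative_eq_intros simp: algebra_simps)
  then have "(G_extremal \<alpha> has_field_derivative
      (0 - (- (of_real \<alpha> + 1) * (1 - z) powr of_real \<alpha>)) / (of_real \<alpha> + 1)) (at z)"
    unfolding G_extremal_def by (intro DERIV_cdivide DERIV_diff DERIV_const)
  moreover have "(0 - (- (c + 1) * w)) / (c + 1) = w" if "c + 1 \<noteq> 0" for c w :: complex
    using that by (simp add: field_simps)
  ultimately show ?thesis by metis
qed

lemma deriv_G_extremal:
  assumes "0 < \<alpha>" "z \<in> ball 0 1"
  shows "deriv (G_extremal \<alpha>) z = (1 - z) powr of_real \<alpha>"
  by (rule DERIV_imp_deriv[OF G_extremal_has_field_derivative[OF assms]])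

lemma deriv_deriv_G_extremal:
  assumes "0 < \<alpha>" "z \<in> ball 0 1"
  shows "deriv (deriv (G_extremal \<alpha>)) z = - of_real \<alpha> * (1 - z) powr (of_real \<alpha> - 1)"
proof -
  have "deriv (deriv (G_extremal \<alpha>)) z = deriv (\<lambda>z. (1 - z) powr of_real \<alpha>) z"
    using deriv_G_extremal[OF assms(1)] assms(2)
    by (intro deriv_cong_ev eventually_nhds_in_open[of "ball 0 1", THEN eventually_mono]) auto
  also have "\<dots> = - of_real \<alpha> * (1 - z) powr (of_real \<alpha> - 1)"
    using one_minus_not_nonpos_Reals[OF assms(2)]
    by (intro DERIV_imp_deriv) (auto intro!: derivative_eq_intros)
  finally show ?thesis .
qed

text \<open>The powers cancel in the quotient, leaving a rational function without branches.\<close>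

lemma pre_schwarzian_G_extremal:
  assumes "0 < \<alpha>" "z \<in> ball 0 1"
  shows "deriv (deriv (G_extremal \<alpha>)) z / deriv (G_extremal \<alpha>) z = - of_real \<alpha> / (1 - z)"
proof -
  have "1 - z \<noteq> 0" using Re_one_minus_pos[OF assms(2)] by auto
  then show ?thesis
    unfolding deriv_G_extremal[OF assms] deriv_deriv_G_extremal[OF assms] by (simp add: powr_diff)
qed

text \<open>Here \<open>z f''/f' = \<alpha> (1 - 1 / (1 - z))\<close>, and
  \<open>1 / (1 - z)\<close> maps the disc into the half-plane \<open>Re > 1/2\<close>.\<close>

lemma G_extremal_in_class_G:
  assumes \<alpha>: "0 < \<alpha>"
  shows "G_extremal \<alpha> \<in> class_G \<alpha>"
proof -
  have "G_extremal \<alpha> analytic_on ball 0 1"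
    unfolding analytic_on_open[OF open_ball] holomorphic_on_open[OF open_ball]
    using G_extremal_has_field_derivative[OF \<alpha>] by blast
  moreover have "deriv (G_extremal \<alpha>) 0 = 1"
    by (simp add: deriv_G_extremal \<alpha>)
  moreover have "deriv (G_extremal \<alpha>) z \<noteq> 0" if "z \<in> ball 0 1" for z
    using Re_one_minus_pos[OF that] by (auto simp: deriv_G_extremal[OF \<alpha> that])
  moreover have "Re (1 + z * deriv (deriv (G_extremal \<alpha>)) z / deriv (G_extremal \<alpha>) z) < 1 + (1/2) * \<alpha>"
    if z: "z \<in> ball 0 1" for z
  proof -
    have nz: "1 - z \<noteq> 0" using Re_one_minus_pos[OF z] by auto
    have "z * deriv (deriv (G_extremal \<alpha>)) z / deriv (G_extremal \<alpha>) z = z * (- of_real \<alpha> / (1 - z))"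
      unfolding pre_schwarzian_G_extremal[OF \<alpha> z, symmetric] by simp
    also have "\<dots> = of_real \<alpha> * (1 - 1 / (1 - z))"
      using nz by (simp add: field_simps)
    finally have eq: "Re (1 + z * deriv (deriv (G_extremal \<alpha>)) z / deriv (G_extremal \<alpha>) z)
        = 1 + \<alpha> * (1 - Re (1 / (1 - z)))"
      by simp
    \<comment> \<open>Expanding gives \<open>1 - 2 Re z + |z|^2\<close>, which is less than
      \<open>2 - 2 Re z\<close> by \<open>|z| < 1\<close>; then divide \<open>Re (1 - z)\<close> by
      the squared norm.\<close>
    have "(norm (1 - z))\<^sup>2 = (1 - Re z)\<^sup>2 + (Im z)\<^sup>2" by (simp add: cmod_power2)
    also have "\<dots> < 2 * Re (1 - z)"
      using z power_strict_mono[of "norm z" 1 2] cmod_power2[of z]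
      by (simp add: power2_eq_square algebra_simps)
    finally have "1 / 2 < Re (1 / (1 - z))"
      using nz by (simp add: Re_divide' divide_simps)
    then have "\<alpha> * (1 - Re (1 / (1 - z))) < \<alpha> * (1/2)"
      using \<alpha> by (intro mult_strict_left_mono) auto
    then show ?thesis unfolding eq by simp
  qed
  ultimately show ?thesis
    by (simp add: class_G_def class_A_def G_extremal_def[of _ 0])
qed

text \<open>All Taylor coefficients of \<open>?g\<close> at 0 equal \<open>- \<alpha>\<close>, so
  the terms \<open>g''(0) = - 2 \<alpha>\<close> and \<open>- g(0) g'(0) = - \<alpha>^2\<close> have
  the same sign and the triangle inequality loses nothing.\<close>

lemma deriv_schwarzian_G_extremal:
  assumes \<alpha>: "0 < \<alpha>"
  shows "deriv (schwarzian (G_extremal \<alpha>)) 0 = - of_real (\<alpha>\<^sup>2 + 2 * \<alpha>)"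
proof -
  let ?g = "\<lambda>z. - complex_of_real \<alpha> / (1 - z)"
  have nz: "1 - z \<noteq> 0" if "z \<in> ball 0 1" for z :: complex
    using Re_one_minus_pos[OF that] by auto
  have d: "deriv ?g z = - of_real \<alpha> / (1 - z)\<^sup>2" if "z \<in> ball 0 1" for z
    using nz[OF that] by (intro DERIV_imp_deriv) (auto intro!: derivative_eq_intros simp: field_simps power2_eq_square)
  have "deriv (deriv ?g) 0 = deriv (\<lambda>z. - of_real \<alpha> / (1 - z)\<^sup>2) 0"
    using d by (intro deriv_cong_ev eventually_nhds_in_open[of "ball 0 1", THEN eventually_mono]) auto
  also have "\<dots> = - 2 * of_real \<alpha>"
    by (intro DERIV_imp_deriv) (auto intro!: derivative_eq_intros)
  finally have dd: "deriv (deriv ?g) 0 = - 2 * of_real \<alpha>" .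
  have "deriv (schwarzian (G_extremal \<alpha>)) 0 = deriv (deriv ?g) 0 - ?g 0 * deriv ?g 0"
    using nz by (intro deriv_schwarzian[where S="ball 0 1"] pre_schwarzian_G_extremal[OF \<alpha>])
       (auto intro!: holomorphic_intros)
  also have "deriv ?g 0 = - of_real \<alpha>" by (subst d) auto
  finally show ?thesis unfolding dd by (simp add: power2_eq_square)
qed

theorem theorem3:
  fixes \<alpha> :: real
  assumes "0 < \<alpha>" and "\<alpha> \<le> 1"
  shows "(\<forall>f\<in>class_G \<alpha>. norm (deriv (schwarzian f) 0) \<le> \<alpha>\<^sup>2 + 2 * \<alpha>) \<and>
         (\<exists>f\<in>class_G \<alpha>. norm (deriv (schwarzian f) 0) = \<alpha>\<^sup>2 + 2 * \<alpha>)"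
proof (intro conjI ballI bexI)
  show "norm (deriv (schwarzian f) 0) \<le> \<alpha>\<^sup>2 + 2 * \<alpha>" if "f \<in> class_G \<alpha>" for f
    by (rule class_G_deriv_schwarzian_bound[OF assms(1) that])
  show "norm (deriv (schwarzian (G_extremal \<alpha>)) 0) = \<alpha>\<^sup>2 + 2 * \<alpha>"
    using assms(1) by (simp only: deriv_schwarzian_G_extremal norm_minus_cancel norm_of_real) simp
  show "G_extremal \<alpha> \<in> class_G \<alpha>"
    by (rule G_extremal_in_class_G[OF assms(1)])
qed

end
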